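(* Let $0<r_{\min}<1<r_{\max}$ and fix a stepsize $h>0$. Let $$N_c=\left\lceil\frac{r_{\max}-r_{\min}}{h}\right\rceil \quad\text{and}\quad N_p=\left\lceil 2\pi\sqrt{2}\,\frac{N_c}{1-\frac{r_{\min}}{r_{\max}}}\right\rceil .$$ Then the concentrated symmetric triangulation $\mathcal{T}$ of the ring built from $r_{\min}$, $r_{\max}$, $N_c$ and $N_p$ (defined in the context) satisfies the strict Delaunay condition, i.e. every angle of every triangle of $\mathcal{T}$ is strictly smaller than $\pi/2$.
   Context: The ring is $\Omega=\{x\in\mathbb{R}^2 : r_{\min}\le |x|\le r_{\max}\}$. Construction of the concentrated symmetric triangulation $\mathcal{T}$ for given positive integers $N_c$ and $N_p$: (1) Radii. Set $$\alpha=\frac{6N_c}{N_c^2+2}\,(r_{\max}-r_{\min}),\qquad f(x)=\alpha\left(x-\tfrac12\right)^2+\frac{r_{\max}-r_{\min}}{2N_c},\quad 0\le x\le 1 .$$ Define $r_1=r_{\min}$ and $r_{j+1}-r_j=f(j/N_c)$ for $1\le j\le N_c$. The value of $\alpha$ is exactly the one for which $\sum_{j=1}^{N_c}(r_{j+1}-r_j)=r_{\max}-r_{\min}$, so that $r_{N_c+1}=r_{\max}$. (2) Vertices. For $1\le j\le N_c+1$ and $1\le k\le N_p$ set $$\tilde{x}_k^j=\left(r_j\cos\left(\tfrac{2(k-1)\pi}{N_p}-\tfrac{(j-1)\pi}{N_p}\right),\ r_j\sin\left(\tfrac{2(k-1)\pi}{N_p}-\tfrac{(j-1)\pi}{N_p}\right)\right),$$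 with the cyclic convention $\tilde{x}_{N_p+1}^j=\tilde{x}_1^j$. (3) Triangles. For $1\le k\le N_p$ and $1\le j\le N_c$, let $\tilde{t}_{k,j}^1$ be the triangle with vertices $\tilde{x}_k^j,\ \tilde{x}_k^{j+1},\ \tilde{x}_{k+1}^{j+1}$ and let $\tilde{t}_{k,j}^2$ be the triangle with vertices $\tilde{x}_k^j,\ \tilde{x}_{k+1}^j,\ \tilde{x}_{k+1}^{j+1}$. Then $\mathcal{T}=(\tilde{t}_{k,j}^l)_{1\le k\le N_p,\ 1\le j\le N_c,\ l=1,2}$. *)

theory Defs
  imports "HOL-Analysis.Analysis"
begin

type_synonym point = "real ^ 2"
type_synonym triangle = "point \<times> point \<times> point"

text \<open>The angle at \<open>b\<close> between the rays from \<open>b\<close> through \<open>a\<close> and \<open>c\<close>. If \<open>a = b\<close> or \<open>c = b\<close>,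
  division by zero makes the value \<open>arccos 0 = pi / 2\<close>, so a triangle with coinciding vertices is
  never counted as acute; one with distinct collinear vertices has an angle \<open>pi\<close>.\<close>

definition vertex_angle :: "point \<Rightarrow> point \<Rightarrow> point \<Rightarrow> real" where
  "vertex_angle a b c = arccos (((a - b) \<bullet> (c - b)) / (norm (a - b) * norm (c - b)))"

definition triangle_angles :: "triangle \<Rightarrow> real set" where
  "triangle_angles t =
     (case t of (a, b, c) \<Rightarrow> {vertex_angle b a c, vertex_angle a b c, vertex_angle a c b})"

definition strict_delaunay :: "triangle set \<Rightarrow> bool" where
  "strict_delaunay T \<longleftrightarrow> (\<forall>t\<in>T. \<forall>\<theta>\<in>triangle_angles t. \<theta> < pi / 2)"

definition conc_alpha :: "real \<Rightarrow> real \<Rightarrow> nat \<Rightarrow> real" where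
  "conc_alpha rmin rmax Nc = 6 * real Nc / ((real Nc)\<^sup>2 + 2) * (rmax - rmin)"

definition conc_step :: "real \<Rightarrow> real \<Rightarrow> nat \<Rightarrow> real \<Rightarrow> real" where
  "conc_step rmin rmax Nc x =
     conc_alpha rmin rmax Nc * (x - 1 / 2)\<^sup>2 + (rmax - rmin) / (2 * real Nc)"

text \<open>The radii are indexed from 1; the value at index 0 is irrelevant.\<close>

primrec conc_radius :: "real \<Rightarrow> real \<Rightarrow> nat \<Rightarrow> nat \<Rightarrow> real" where
  "conc_radius rmin rmax Nc 0 = 0"
| "conc_radius rmin rmax Nc (Suc j) =
     (if j = 0 then rmin
      else conc_radius rmin rmax Nc j + conc_step rmin rmax Nc (real j / real Nc))"

definition conc_vertex :: "real \<Rightarrow> real \<Rightarrow> nat \<Rightarrow> nat \<Rightarrow> nat \<Rightarrow> nat \<Rightarrow> point" where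
  "conc_vertex rmin rmax Nc Np k j =
     (let r = conc_radius rmin rmax Nc j;
          \<phi> = 2 * (real k - 1) * pi / real Np - (real j - 1) * pi / real Np
      in vector [r * cos \<phi>, r * sin \<phi>])"

definition conc_triangle1 :: "real \<Rightarrow> real \<Rightarrow> nat \<Rightarrow> nat \<Rightarrow> nat \<Rightarrow> nat \<Rightarrow> triangle" where
  "conc_triangle1 rmin rmax Nc Np k j =
     (conc_vertex rmin rmax Nc Np k j,
      conc_vertex rmin rmax Nc Np k (j + 1),
      conc_vertex rmin rmax Nc Np (k + 1) (j + 1))"

definition conc_triangle2 :: "real \<Rightarrow> real \<Rightarrow> nat \<Rightarrow> nat \<Rightarrow> nat \<Rightarrow> nat \<Rightarrow> triangle" where
  "conc_triangle2 rmin rmax Nc Np k j =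
     (conc_vertex rmin rmax Nc Np k j,
      conc_vertex rmin rmax Nc Np (k + 1) j,
      conc_vertex rmin rmax Nc Np (k + 1) (j + 1))"

definition conc_triangulation :: "real \<Rightarrow> real \<Rightarrow> nat \<Rightarrow> nat \<Rightarrow> triangle set" where
  "conc_triangulation rmin rmax Nc Np =
     (\<Union>k\<in>{1..Np}. \<Union>j\<in>{1..Nc}.
        {conc_triangle1 rmin rmax Nc Np k j, conc_triangle2 rmin rmax Nc Np k j})"

text \<open>The cyclic convention for the vertices needs no separate clause: it holds by periodicity.\<close>

lemma conc_vertex_cyclic:
  assumes "Np \<ge> 1"
  shows "conc_vertex rmin rmax Nc Np (Np + 1) j = conc_vertex rmin rmax Nc Np 1 j"
proof -
  have "2 * (real (Np + 1) - 1) * pi / real Np - (real j - 1) * pi / real Np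
      = (2 * (real 1 - 1) * pi / real Np - (real j - 1) * pi / real Np) + 2 * pi"
    using assms by (simp add: field_simps)
  then show ?thesis
    unfolding conc_vertex_def Let_def by (simp only: sin_periodic cos_periodic)
qed

lemma conc_radius_outer:
  assumes "Nc \<ge> 1"
  shows "conc_radius rmin rmax Nc (Nc + 1) = rmax"
proof -
  have rad: "conc_radius rmin rmax Nc (Suc n)
      = rmin + (\<Sum>j=1..n. conc_step rmin rmax Nc (real j / real Nc))" for n
    by (induction n) auto
  define N where "N = real Nc"
  have N: "N > 0" using assms by (simp add: N_def)
  have sq: "(\<Sum>j=1..n. (real j / N - 1 / 2)\<^sup>2)
      = real n * (real n + 1) * (2 * real n + 1) / (6 * N\<^sup>2) - real n * (real n + 1) / (2 * N) + real n / 4"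
    for n
  proof (induction n)
    case (Suc n)
    have "(\<Sum>j=1..Suc n. (real j / N - 1 / 2)\<^sup>2)
        = (\<Sum>j=1..n. (real j / N - 1 / 2)\<^sup>2) + (real (Suc n) / N - 1 / 2)\<^sup>2"
      by simp
    also have "\<dots> = real (Suc n) * (real (Suc n) + 1) * (2 * real (Suc n) + 1) / (6 * N\<^sup>2)
        - real (Suc n) * (real (Suc n) + 1) / (2 * N) + real (Suc n) / 4"
      unfolding Suc.IH using N by (simp add: field_simps power2_eq_square)
    finally show ?case .
  qed simp
  have tot: "(\<Sum>j=1..Nc. (real j / N - 1 / 2)\<^sup>2) = (N\<^sup>2 + 2) / (12 * N)"
    unfolding sq N_def[symmetric] using N by (simp add: field_simps power2_eq_square)
  have pos: "N\<^sup>2 + 2 \<noteq> 0" using N by (smt (verit) zero_le_power2)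
  have "(\<Sum>j=1..Nc. conc_step rmin rmax Nc (real j / real Nc))
      = conc_alpha rmin rmax Nc * ((N\<^sup>2 + 2) / (12 * N)) + N * ((rmax - rmin) / (2 * N))"
    unfolding conc_step_def N_def[symmetric] sum.distrib sum_distrib_left[symmetric] tot
    by (simp add: N_def)
  also have "\<dots> = rmax - rmin"
  proof -
    have "6 * N / (N\<^sup>2 + 2) * d * ((N\<^sup>2 + 2) / (12 * N)) = d / 2" for d
      using N pos by simp
    moreover have "N * (d / (2 * N)) = d / 2" for d
      using N by simp
    ultimately show ?thesis
      unfolding conc_alpha_def N_def[symmetric] by (simp only: field_sum_of_halves)
  qed
  finally show ?thesis using rad[of Nc] by simp
qed

end

theory Submission
  imports Defs
begin

text \<open>Put \<open>\<phi> = pi / Np\<close> and let \<open>r < R\<close> be consecutive radii. Both kinds of triangles are isosceles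
  and symmetric about a ray from the origin: the apex has radius \<open>r\<close> (resp.\ \<open>R\<close>) and the base
  vertices have radius \<open>R\<close> (resp.\ \<open>r\<close>) at angular distance \<open>\<phi>\<close> from the apex. Base angles are
  acute, and the apex angle is acute iff the height exceeds half of the base, which for both kinds
  follows from \<open>r < R * (cos \<phi> - sin \<phi>)\<close>. Every radial step is at least \<open>(rmax - rmin) / (2 * Nc)\<close>,
  so \<open>R - r \<ge> R * s\<close> with \<open>s = (1 - rmin / rmax) / (2 * Nc) < 1 / 2\<close>, while the choice of \<open>Np\<close> gives
  \<open>sqrt 2 * \<phi> \<le> s\<close>, hence \<open>1 - cos \<phi> + sin \<phi> \<le> \<phi> + \<phi>\<^sup>2 / 2 < s\<close>.\<close>

definition polar :: "real \<Rightarrow> real \<Rightarrow> point" where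
  "polar r a = vector [r * cos a, r * sin a]"

text \<open>Bilinear expansion: two polar points have inner product equal to the product of their
  radii times the cosine of the angle difference.\<close>

lemma inner_polar_diff:
  "(polar r a - polar s b) \<bullet> (polar t c - polar s b)
     = r * t * cos (a - c) - r * s * cos (a - b) - s * t * cos (b - c) + s\<^sup>2"
proof -
  have "s * (s * (cos b * cos b)) + s * (s * (sin b * sin b)) = s * s * ((sin b)\<^sup>2 + (cos b)\<^sup>2)"
    unfolding power2_eq_square by algebra
  then have "s * (s * (cos b * cos b)) + s * (s * (sin b * sin b)) = s * s"
    by simp
  then show ?thesis
    by (simp add: polar_def inner_vec_def sum_2 cos_diff algebra_simps power2_eq_square)
qed

text \<open>Positivity forces both sides to be nonzero, so the quotient is positive and, by
  Cauchy-Schwarz, at most 1; \<open>arccos\<close> is strictly decreasing there and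
  \<open>arccos 0 = pi / 2\<close>.\<close>

lemma vertex_angle_acute:
  assumes "(a - b) \<bullet> (c - b) > 0"
  shows "vertex_angle a b c < pi / 2"
proof -
  let ?n = "norm (a - b) * norm (c - b)"
  have "(a - b) \<bullet> (c - b) \<le> ?n"
    by (rule norm_cauchy_schwarz)
  with assms have "0 < (a - b) \<bullet> (c - b) / ?n" "(a - b) \<bullet> (c - b) / ?n \<le> 1"
    by simp_all
  then show ?thesis
    unfolding vertex_angle_def using arccos_less_arccos[of 0] by simp
qed

lemma vertex_angle_commute: "vertex_angle a b c = vertex_angle c b a"
  by (simp add: vertex_angle_def inner_commute mult.commute)

lemma triangle_angles_rotate: "triangle_angles (a, b, c) = triangle_angles (c, a, b)"
  unfolding triangle_angles_def using vertex_angle_commute by auto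

text \<open>The base midpoint lies at signed radius \<open>t * cos \<phi>\<close> on the axis, so
  \<open>height\<close> compares half the base with the height. The inner product at the apex is the
  difference of their squares; at a base vertex it is twice the squared half base.\<close>

lemma polar_isosceles_acute:
  assumes "t \<noteq> 0" and "sin \<phi> \<noteq> 0" and height: "\<bar>t * sin \<phi>\<bar> < \<bar>s - t * cos \<phi>\<bar>"
    and "\<theta> \<in> triangle_angles (polar s a, polar t (a - \<phi>), polar t (a + \<phi>))"
  shows "\<theta> < pi / 2"
proof -
  let ?A = "polar s a" and ?B = "polar t (a - \<phi>)" and ?C = "polar t (a + \<phi>)"
  have "(t * sin \<phi>)\<^sup>2 < (s - t * cos \<phi>)\<^sup>2"
    using height by (metis abs_ge_zero power2_abs power_strict_mono zero_less_numeral)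
  moreover have "(?B - ?A) \<bullet> (?C - ?A) = (s - t * cos \<phi>)\<^sup>2 - (t * sin \<phi>)\<^sup>2"
  proof -
    have "a - \<phi> - (a + \<phi>) = - (2 * \<phi>)"
      by simp
    then show ?thesis
      unfolding inner_polar_diff by (simp add: cos_double) (simp add: algebra_simps power2_eq_square)
  qed
  ultimately have "vertex_angle ?B ?A ?C < pi / 2"
    by (intro vertex_angle_acute) simp
  moreover have "vertex_angle ?A ?B ?C < pi / 2" "vertex_angle ?A ?C ?B < pi / 2"
  proof -
    have base: "(?A - ?B) \<bullet> (?C - ?B) = 2 * (t * sin \<phi>)\<^sup>2"
      "(?A - ?C) \<bullet> (?B - ?C) = 2 * (t * sin \<phi>)\<^sup>2"
    proof -
      have "a - \<phi> - (a + \<phi>) = - (2 * \<phi>)" "a + \<phi> - (a - \<phi>) = 2 * \<phi>"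
        by simp_all
      then show "(?A - ?B) \<bullet> (?C - ?B) = 2 * (t * sin \<phi>)\<^sup>2"
        "(?A - ?C) \<bullet> (?B - ?C) = 2 * (t * sin \<phi>)\<^sup>2"
        unfolding inner_polar_diff by (simp_all add: cos_double_sin) (simp_all add: algebra_simps power2_eq_square)
    qed
    have "0 < (t * sin \<phi>)\<^sup>2"
      using assms(1,2) by simp
    then show "vertex_angle ?A ?B ?C < pi / 2" "vertex_angle ?A ?C ?B < pi / 2"
      by (intro vertex_angle_acute; simp add: base)+
  qed
  ultimately show ?thesis
    using assms(4) by (auto simp: triangle_angles_def)
qed

lemma annular_triangles_acute:
  assumes "0 < r" and "0 < \<phi>" "\<phi> < pi" and gap: "r < R * (cos \<phi> - sin \<phi>)" and "0 < R"
  shows "\<theta> \<in> triangle_angles (polar r a, polar R (a - \<phi>), polar R (a + \<phi>)) \<Longrightarrow> \<theta> < pi / 2"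
    and "\<theta> \<in> triangle_angles (polar R a, polar r (a - \<phi>), polar r (a + \<phi>)) \<Longrightarrow> \<theta> < pi / 2"
proof -
  have s: "sin \<phi> > 0"
    using assms by (intro sin_gt_zero)
  \<comment> \<open>For the apex on the inner circle, the height condition is just
    \<open>gap\<close> rearranged.\<close>
  have inner: "\<bar>R * sin \<phi>\<bar> < \<bar>r - R * cos \<phi>\<bar>"
    using gap s \<open>0 < R\<close> by (simp add: algebra_simps abs_mult)
  have d: "cos \<phi> - sin \<phi> > 0"
    using gap \<open>0 < r\<close> \<open>0 < R\<close> zero_less_mult_pos[of R "cos \<phi> - sin \<phi>"] by linarith
  \<comment> \<open>For the apex on the outer circle
    \<open>r * (cos \<phi> + sin \<phi>) < R\<close> is needed; multiplying \<open>gap\<close> by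
    \<open>cos \<phi> + sin \<phi>\<close> turns its right side into
    \<open>R * cos (2 * \<phi>)\<close>.\<close>
  then have "r * (cos \<phi> + sin \<phi>) < R * (cos \<phi> - sin \<phi>) * (cos \<phi> + sin \<phi>)"
    using gap s by (intro mult_strict_right_mono) auto
  also have "\<dots> = R * cos (2 * \<phi>)"
    unfolding cos_double by (simp add: algebra_simps power2_eq_square)
  also have "\<dots> \<le> R"
    using \<open>0 < R\<close> by simp
  finally have outer: "\<bar>r * sin \<phi>\<bar> < \<bar>R - r * cos \<phi>\<bar>"
    using s \<open>0 < r\<close> by (simp add: algebra_simps abs_mult)
  show "\<theta> < pi / 2" if "\<theta> \<in> triangle_angles (polar r a, polar R (a - \<phi>), polar R (a + \<phi>))"
    using polar_isosceles_acute[OF _ _ inner that] \<open>0 < R\<close> s by simp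
  show "\<theta> < pi / 2" if "\<theta> \<in> triangle_angles (polar R a, polar r (a - \<phi>), polar r (a + \<phi>))"
    using polar_isosceles_acute[OF _ _ outer that] \<open>0 < r\<close> s by simp
qed

lemma conc_step_ge:
  assumes "rmin \<le> rmax"
  shows "(rmax - rmin) / (2 * real Nc) \<le> conc_step rmin rmax Nc x"
  using assms by (simp add: conc_step_def conc_alpha_def)

lemma conc_radius_mono:
  assumes "rmin \<le> rmax" and "1 \<le> i" and "i \<le> j"
  shows "conc_radius rmin rmax Nc i \<le> conc_radius rmin rmax Nc j"
  using assms(3)
proof (induction j rule: dec_induct)
  case (step n)
  have "0 \<le> (rmax - rmin) / (2 * real Nc)"
    using assms(1) by simp
  also have "\<dots> \<le> conc_step rmin rmax Nc (real n / real Nc)"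
    using assms(1) by (rule conc_step_ge)
  finally show ?case
    using step assms(2) by simp
qed simp

lemma one_minus_cos_plus_sin_less:
  fixes \<phi> s :: real
  assumes "0 < \<phi>" and "sqrt 2 * \<phi> \<le> s" and "s \<le> 1 / 2"
  shows "1 - cos \<phi> + sin \<phi> < s"
proof -
  have "\<bar>sin (\<phi> / 2)\<bar> \<le> \<bar>\<phi> / 2\<bar>"
    by (rule abs_sin_x_le_abs_x)
  then have "(sin (\<phi> / 2))\<^sup>2 \<le> (\<phi> / 2)\<^sup>2"
    by (simp only: abs_le_square_iff)
  moreover have "cos \<phi> = 1 - 2 * (sin (\<phi> / 2))\<^sup>2"
    using cos_double_sin[of "\<phi> / 2"] by simp
  ultimately have cos: "1 - cos \<phi> \<le> \<phi>\<^sup>2 / 2"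
    by (simp add: power2_eq_square)
  have sin: "sin \<phi> \<le> \<phi>"
    using assms(1) by (intro sin_x_le_x) simp
  \<comment> \<open>A rational substitute for \<open>sqrt 2\<close>: as
    \<open>\<phi> \<le> 1 / 2\<close>, the left side of the goal is at most
    \<open>5 / 4 * \<phi>\<close>, strictly below \<open>7 / 5 * \<phi>\<close>.\<close>
  have "7 / 5 \<le> sqrt 2"
    by (rule real_le_rsqrt) (simp add: power2_eq_square)
  then have "7 / 5 * \<phi> \<le> sqrt 2 * \<phi>"
    using assms(1) by (intro mult_right_mono) auto
  with assms have "7 / 5 * \<phi> \<le> s" "\<phi> \<le> 1 / 2"
    by linarith+
  moreover from \<open>\<phi> \<le> 1 / 2\<close> have "\<phi>\<^sup>2 \<le> 1 / 2 * \<phi>"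
    unfolding power2_eq_square using assms(1) by (intro mult_right_mono) auto
  ultimately show ?thesis
    using cos sin assms(1) by linarith
qed

theorem proposition1:
  fixes rmin rmax h :: real and Nc Np :: nat
  assumes "0 < rmin" and "rmin < 1" and "1 < rmax"
    and "h > 0"
    and "Nc = nat \<lceil>(rmax - rmin) / h\<rceil>"
    and "Np = nat \<lceil>2 * pi * sqrt 2 * (real Nc / (1 - rmin / rmax))\<rceil>"
  shows "strict_delaunay (conc_triangulation rmin rmax Nc Np)"
proof -
  define \<phi> where "\<phi> = pi / real Np"
  define d where "d = 1 - rmin / rmax"
  define s where "s = d / (2 * real Nc)"
  have lt: "rmin < rmax"
    using assms by simp
  have d: "0 < d" "d < 1"
    using assms by (simp_all add: d_def)
  have Nc: "Nc \<ge> 1"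
    using assms lt by (simp add: Suc_le_eq)
  have s: "0 < s" "s \<le> 1 / 2"
    using d Nc by (simp_all add: s_def field_simps)
  have "2 * pi * sqrt 2 * (real Nc / d) \<le> real Np"
    unfolding assms(6) d_def by (rule real_nat_ceiling_ge)
  then have Np: "pi * sqrt 2 / s \<le> real Np"
    by (simp add: s_def field_simps)
  moreover have "0 < pi * sqrt 2 / s"
    using s by simp
  ultimately have "0 < real Np"
    by linarith
  with Np s have \<phi>: "0 < \<phi>" "sqrt 2 * \<phi> \<le> s"
    by (simp_all add: \<phi>_def field_simps)
  have "\<phi> \<le> sqrt 2 * \<phi>"
    using \<phi>(1) by simp
  then have "\<phi> < pi"
    using \<phi>(2) s(2) pi_gt3 by linarith
  have key: "1 - cos \<phi> + sin \<phi> < s"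
    using \<phi> s(2) by (rule one_minus_cos_plus_sin_less)
  have acute: "\<theta> < pi / 2"
    if j: "1 \<le> j" "j \<le> Nc"
      and \<theta>: "\<theta> \<in> triangle_angles (conc_triangle1 rmin rmax Nc Np k j) \<union>
                  triangle_angles (conc_triangle2 rmin rmax Nc Np k j)" for k j \<theta>
  proof -
    define r where "r = conc_radius rmin rmax Nc j"
    define R where "R = conc_radius rmin rmax Nc (j + 1)"
    define a where "a = 2 * (real k - 1) * pi / real Np - (real j - 1) * pi / real Np"
    have r: "0 < r"
      using conc_radius_mono[of rmin rmax 1 j Nc] j lt assms(1) by (simp add: r_def)
    \<comment> \<open>The smallest possible step equals \<open>rmax * s\<close>; bounding
      \<open>R\<close> by the outermost radius makes the estimate proportional to \<open>R\<close>,
      as \<open>gap\<close> requires.\<close>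
    have "R \<le> rmax"
      using conc_radius_mono[of rmin rmax "j + 1" "Nc + 1" Nc] conc_radius_outer[OF Nc] j lt
      by (simp add: R_def)
    then have "R * s \<le> rmax * s"
      using s by simp
    also have "rmax * s = (rmax - rmin) / (2 * real Nc)"
      using assms(3) Nc by (simp add: s_def d_def field_simps)
    also have "\<dots> \<le> R - r"
      using conc_step_ge[of rmin rmax Nc "real j / real Nc"] lt j by (simp add: R_def r_def)
    finally have step: "R * s \<le> R - r" .
    have R: "0 < R"
      using conc_radius_mono[of rmin rmax j "j + 1" Nc] j lt r by (simp add: R_def r_def)
    have "R * (1 - cos \<phi> + sin \<phi>) < R * s"
      using key R by simp
    with step have gap: "r < R * (cos \<phi> - sin \<phi>)"
      by (simp add: algebra_simps)
    \<comment> \<open>Each level is turned back by \<open>\<phi>\<close>, half the angular spacing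
      \<open>2 * \<phi>\<close> within a level, so the two outer vertices lie symmetrically about
      direction \<open>a\<close>.\<close>
    have v: "conc_vertex rmin rmax Nc Np k j = polar r a"
      "conc_vertex rmin rmax Nc Np (k + 1) j = polar r (a + 2 * \<phi>)"
      "conc_vertex rmin rmax Nc Np k (j + 1) = polar R (a - \<phi>)"
      "conc_vertex rmin rmax Nc Np (k + 1) (j + 1) = polar R (a + \<phi>)"
    proof -
      have eqs: "2 * (real (k + 1) - 1) * pi / real Np - (real j - 1) * pi / real Np = a + 2 * \<phi>"
        "2 * (real k - 1) * pi / real Np - (real (j + 1) - 1) * pi / real Np = a - \<phi>"
        "2 * (real (k + 1) - 1) * pi / real Np - (real (j + 1) - 1) * pi / real Np = a + \<phi>"
        using \<open>0 < real Np\<close> by (simp_all add: a_def \<phi>_def field_simps)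
      show "conc_vertex rmin rmax Nc Np k j = polar r a"
        "conc_vertex rmin rmax Nc Np (k + 1) j = polar r (a + 2 * \<phi>)"
        "conc_vertex rmin rmax Nc Np k (j + 1) = polar R (a - \<phi>)"
        "conc_vertex rmin rmax Nc Np (k + 1) (j + 1) = polar R (a + \<phi>)"
        unfolding conc_vertex_def Let_def eqs polar_def r_def R_def
        by (simp_all only: a_def)
    qed
    note acute = annular_triangles_acute[OF r \<phi>(1) \<open>\<phi> < pi\<close> gap R, of \<theta>]
    \<comment> \<open>The apex of the second kind, in direction \<open>a + \<phi>\<close>, is listed
      last and is rotated to the front.\<close>
    have "triangle_angles (conc_triangle2 rmin rmax Nc Np k j)
        = triangle_angles (polar R (a + \<phi>), polar r (a + \<phi> - \<phi>), polar r (a + \<phi> + \<phi>))"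
      by (simp add: conc_triangle2_def v[simplified] triangle_angles_rotate[of "polar r a"] add.commute)
    with \<theta> acute(1)[of a] acute(2)[of "a + \<phi>"] show ?thesis
      unfolding conc_triangle1_def v by blast
  qed
  then show ?thesis
    unfolding strict_delaunay_def conc_triangulation_def by fastforce
qed

end
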